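(* There exists a locally nilpotent ring $R$ and a derivation $D$ of $R$ such that the differential polynomial ring $R[X;D]$ is not Jacobson radical, i.e. $J(R[X;D])\neq R[X;D]$.
   Context: A ring is locally nilpotent if every finitely generated subring is nilpotent. For a derivation $D$ of $R$, $R[X;D]$ is the ring of polynomials $\sum a_iX^i$, $a_i\in R$, with pointwise addition and multiplication determined by $X^iX^j=X^{i+j}$ and $Xa=aX+D(a)$. $J(\cdot)$ denotes the Jacobson radical; a ring $S$ is Jacobson radical if $J(S)=S$. *)

theory Defs
  imports "HOL-Algebra.Ring"
begin

text \<open>Associative rings, not necessarily with identity (the field one of the
record is ignored throughout).\<close>
definition rng :: "('a, 'b) ring_scheme \<Rightarrow> bool" where
  "rng R \<longleftrightarrow> abelian_group R
     \<and> (\<forall>x\<in>carrier R. \<forall>y\<in>carrier R. x \<otimes>\<^bsub>R\<^esub> y \<in> carrier R)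
     \<and> (\<forall>x\<in>carrier R. \<forall>y\<in>carrier R. \<forall>z\<in>carrier R.
          (x \<otimes>\<^bsub>R\<^esub> y) \<otimes>\<^bsub>R\<^esub> z = x \<otimes>\<^bsub>R\<^esub> (y \<otimes>\<^bsub>R\<^esub> z))
     \<and> (\<forall>x\<in>carrier R. \<forall>y\<in>carrier R. \<forall>z\<in>carrier R.
          (x \<oplus>\<^bsub>R\<^esub> y) \<otimes>\<^bsub>R\<^esub> z = x \<otimes>\<^bsub>R\<^esub> z \<oplus>\<^bsub>R\<^esub> y \<otimes>\<^bsub>R\<^esub> z
        \<and> z \<otimes>\<^bsub>R\<^esub> (x \<oplus>\<^bsub>R\<^esub> y) = z \<otimes>\<^bsub>R\<^esub> x \<oplus>\<^bsub>R\<^esub> z \<otimes>\<^bsub>R\<^esub> y)"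

inductive_set gen_subrng :: "('a, 'b) ring_scheme \<Rightarrow> 'a set \<Rightarrow> 'a set"
  for R and S where
  gen_incl: "x \<in> S \<Longrightarrow> x \<in> gen_subrng R S"
| gen_zero: "\<zero>\<^bsub>R\<^esub> \<in> gen_subrng R S"
| gen_neg: "x \<in> gen_subrng R S \<Longrightarrow> \<ominus>\<^bsub>R\<^esub> x \<in> gen_subrng R S"
| gen_add: "x \<in> gen_subrng R S \<Longrightarrow> y \<in> gen_subrng R S \<Longrightarrow> x \<oplus>\<^bsub>R\<^esub> y \<in> gen_subrng R S"
| gen_mult: "x \<in> gen_subrng R S \<Longrightarrow> y \<in> gen_subrng R S \<Longrightarrow> x \<otimes>\<^bsub>R\<^esub> y \<in> gen_subrng R S"

fun prodl :: "('a, 'b) ring_scheme \<Rightarrow> 'a list \<Rightarrow> 'a" where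
  "prodl R [] = undefined"
| "prodl R [x] = x"
| "prodl R (x # y # xs) = x \<otimes>\<^bsub>R\<^esub> prodl R (y # xs)"

text \<open>A subring S is nilpotent if S^n = 0 for some n >= 1, i.e. every product of
n elements of S vanishes (S^n is additively spanned by such products).\<close>
definition nilpotent_set :: "('a, 'b) ring_scheme \<Rightarrow> 'a set \<Rightarrow> bool" where
  "nilpotent_set R S \<longleftrightarrow> (\<exists>n\<ge>1. \<forall>xs. length xs = n \<and> set xs \<subseteq> S \<longrightarrow> prodl R xs = \<zero>\<^bsub>R\<^esub>)"

definition locally_nilpotent :: "('a, 'b) ring_scheme \<Rightarrow> bool" where
  "locally_nilpotent R \<longleftrightarrow>
     (\<forall>F. finite F \<and> F \<subseteq> carrier R \<longrightarrow> nilpotent_set R (gen_subrng R F))"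

definition derivation :: "('a, 'b) ring_scheme \<Rightarrow> ('a \<Rightarrow> 'a) \<Rightarrow> bool" where
  "derivation R D \<longleftrightarrow> D \<in> carrier R \<rightarrow> carrier R
     \<and> (\<forall>x\<in>carrier R. \<forall>y\<in>carrier R. D (x \<oplus>\<^bsub>R\<^esub> y) = D x \<oplus>\<^bsub>R\<^esub> D y)
     \<and> (\<forall>x\<in>carrier R. \<forall>y\<in>carrier R.
          D (x \<otimes>\<^bsub>R\<^esub> y) = D x \<otimes>\<^bsub>R\<^esub> y \<oplus>\<^bsub>R\<^esub> x \<otimes>\<^bsub>R\<^esub> D y)"

text \<open>The differential polynomial ring R[X;D]. A polynomial sum a_i X^i is its
coefficient sequence (finite support in R). Multiplication is determined by
X^i X^j = X^(i+j) and X a = a X + D(a), which yields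
X^i b = sum_k (i choose k) D^k(b) X^(i-k), hence
(a_i X^i)(b_j X^j) = sum_{k<=i} (i choose k) a_i D^k(b_j) X^(i+j-k).\<close>
definition diff_poly_ring :: "('a, 'b) ring_scheme \<Rightarrow> ('a \<Rightarrow> 'a) \<Rightarrow> (nat \<Rightarrow> 'a) ring" where
  "diff_poly_ring R D =
    \<lparr> carrier = {f. (\<forall>n. f n \<in> carrier R) \<and> finite {n. f n \<noteq> \<zero>\<^bsub>R\<^esub>}},
      monoid.mult = (\<lambda>f g n.
         \<Oplus>\<^bsub>R\<^esub> i \<in> {i. f i \<noteq> \<zero>\<^bsub>R\<^esub>}.
           \<Oplus>\<^bsub>R\<^esub> k \<in> {k. k \<le> i \<and> i \<le> n + k}.
             add_pow R (i choose k) (f i \<otimes>\<^bsub>R\<^esub> (D ^^ k) (g (n + k - i)))),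
      one = undefined,
      zero = (\<lambda>n. \<zero>\<^bsub>R\<^esub>),
      add = (\<lambda>f g n. f n \<oplus>\<^bsub>R\<^esub> g n) \<rparr>"

definition right_quasi_regular :: "('a, 'b) ring_scheme \<Rightarrow> 'a \<Rightarrow> bool" where
  "right_quasi_regular R x \<longleftrightarrow> x \<in> carrier R \<and>
     (\<exists>y\<in>carrier R. x \<oplus>\<^bsub>R\<^esub> y \<ominus>\<^bsub>R\<^esub> x \<otimes>\<^bsub>R\<^esub> y = \<zero>\<^bsub>R\<^esub>)"

definition right_ideal :: "('a, 'b) ring_scheme \<Rightarrow> 'a set \<Rightarrow> bool" where
  "right_ideal R I \<longleftrightarrow> I \<subseteq> carrier R \<and> \<zero>\<^bsub>R\<^esub> \<in> I
     \<and> (\<forall>x\<in>I. \<forall>y\<in>I. x \<oplus>\<^bsub>R\<^esub> y \<in> I) \<and> (\<forall>x\<in>I. \<ominus>\<^bsub>R\<^esub> x \<in> I)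
     \<and> (\<forall>x\<in>I. \<forall>r\<in>carrier R. x \<otimes>\<^bsub>R\<^esub> r \<in> I)"

text \<open>Jacobson radical of a ring without identity (Jacobson): the sum of all
right quasi-regular right ideals (this sum is again right quasi-regular, so it
coincides with the union taken here).\<close>
definition jacobson_radical :: "('a, 'b) ring_scheme \<Rightarrow> 'a set" where
  "jacobson_radical R =
     \<Union>{I. right_ideal R I \<and> (\<forall>x\<in>I. right_quasi_regular R x)}"

end

theory Submission
  imports Defs HOL.Modules "HOL-Library.Function_Algebras" "HOL-Library.Countable_Set"
begin

text \<open>The ring R acts on a module whose states are pairs of a position n and a monomial in variables
v_0, v_1, ...; the variable v_j is open at n if the j-th ternary digit of n is 1. X multiplies by the
sum of the open variables, and a moves from n to n + 1, extracting the coefficient of v_j^(2^j) when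
v_j gets closed. R is spanned by the nonempty words in x_i = D^i(a), where D = [X, -].

The x_i with i at most m generate a nilpotent ring: opening v_J contributes v_J^i, closing it
contributes v_J^k up to sign, and nothing else in between touches v_J, so traversing the block needs
i + k = 2^J; but every sufficiently long run of positions contains a block with 2^J > 2m.

On the other hand aX is not nilpotent: inside a block of v_J there are exactly 2^J positions where v_J
is the innermost open variable, and X may raise its exponent at each of them. Since a quasi-inverse
of aX moves positions by a bounded amount, it cannot exist.\<close>

section \<open>Ternary digits of a position and the carry from n to n + 1\<close>

text \<open>The number of trailing ternary digits 2 of n, hence the place of the digit that grows
  when n is replaced by n + 1.\<close>

fun lev :: "nat \<Rightarrow> nat" where
  "lev n = (if n mod 3 = 2 then Suc (lev (n div 3)) else 0)"

declare lev.simps [simp del]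

definition dig :: "nat \<Rightarrow> nat \<Rightarrow> nat" where
  "dig n j = n div 3 ^ j mod 3"

definition opn :: "nat \<Rightarrow> nat set" where
  "opn n = {j. dig n j = 1}"

lemma dig_0: "dig n 0 = n mod 3"
  by (simp add: dig_def)

lemma dig_Suc: "dig n (Suc j) = dig (n div 3) j"
  by (simp add: dig_def div_mult2_eq)

lemma Suc_div_3: "Suc n div 3 = (if n mod 3 = 2 then Suc (n div 3) else n div 3)"
  by presburger

text \<open>This and the next two lemmas are addition of 1 with carry, by recursion along
  \<open>n div 3\<close>: a last digit 2 passes the carry on, any other last digit absorbs
  it.\<close>

lemma dig_below_lev: "l < lev n \<Longrightarrow> dig n l = 2 \<and> dig (Suc n) l = 0"
proof (induction n arbitrary: l rule: lev.induct)
  case (1 n)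
  have m: "n mod 3 = 2" using 1(2) by (subst (asm) lev.simps) (auto split: if_splits)
  then have l: "l < Suc (lev (n div 3))" using 1(2) by (subst (asm) lev.simps) auto
  have m': "Suc n mod 3 = 0" using m by presburger
  show ?case
  proof (cases l)
    case 0
    then show ?thesis using m m' by (simp add: dig_0)
  next
    case (Suc k)
    then show ?thesis using 1(1)[OF m, of k] l m by (simp add: dig_Suc Suc_div_3)
  qed
qed

lemma dig_lev: "dig n (lev n) < 2 \<and> dig (Suc n) (lev n) = Suc (dig n (lev n))"
proof (induction n rule: lev.induct)
  case (1 n)
  show ?case
  proof (cases "n mod 3 = 2")
    case True
    then have "lev n = Suc (lev (n div 3))" by (simp add: lev.simps)
    then show ?thesis using 1 True by (simp add: dig_Suc Suc_div_3)
  next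
    case False
    then have "lev n = 0" by (simp add: lev.simps)
    moreover have "n mod 3 < 2" "Suc n mod 3 = Suc (n mod 3)" using False by presburger+
    ultimately show ?thesis by (simp add: dig_0)
  qed
qed

lemma dig_above_lev: "lev n < l \<Longrightarrow> dig (Suc n) l = dig n l"
proof (induction n arbitrary: l rule: lev.induct)
  case (1 n)
  obtain k where l: "l = Suc k" using 1(2) by (cases l) auto
  show ?case
  proof (cases "n mod 3 = 2")
    case True
    then have "lev n = Suc (lev (n div 3))" by (simp add: lev.simps)
    then show ?thesis using 1 True l by (simp add: dig_Suc Suc_div_3)
  next
    case False
    then show ?thesis using l by (simp add: dig_Suc Suc_div_3)
  qed
qed

text \<open>Only the variable at \<open>lev n\<close> changes status: the lower digits are 2 before
  the step and 0 after it, which both mean closed.\<close>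

lemma opn_Suc:
  "opn (Suc n) = (if dig n (lev n) = 0 then insert (lev n) (opn n) else opn n - {lev n})"
proof -
  have "l \<in> opn (Suc n) \<longleftrightarrow> (if dig n (lev n) = 0 then l = lev n \<or> l \<in> opn n else l \<in> opn n \<and> l \<noteq> lev n)" for l
  proof (cases l "lev n" rule: linorder_cases)
    case less
    then show ?thesis using dig_below_lev[OF less] by (simp add: opn_def)
  next
    case equal
    have "dig n (lev n) = 0 \<or> dig n (lev n) = 1" using dig_lev[of n] by linarith
    then show ?thesis using dig_lev[of n] equal by (auto simp: opn_def)
  next
    case greater
    then show ?thesis using dig_above_lev[OF greater] by (simp add: opn_def)
  qed
  then show ?thesis by (intro Set.set_eqI) simp
qed

lemma lev_in_opn_iff: "lev n \<in> opn n \<longleftrightarrow> dig n (lev n) \<noteq> 0"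
  using dig_lev[of n] by (auto simp: opn_def)

text \<open>Digits beyond the length of n are 0. Over an infinite index set the sum in
  \<open>xop\<close> would take the default value 0.\<close>

lemma finite_opn: "finite (opn n)"
proof -
  have "j < n" if "j \<in> opn n" for j
  proof (rule ccontr)
    assume "\<not> j < n"
    moreover have "j < 2 ^ j" by (rule less_exp)
    moreover have "(2::nat) ^ j \<le> 3 ^ j" by (rule power_mono) auto
    ultimately have "n < 3 ^ j" by linarith
    with that show False by (simp add: opn_def dig_def)
  qed
  then have "opn n \<subseteq> {..<n}" by auto
  then show ?thesis using finite_subset by blast
qed

text \<open>Trailing digits 2 of n are trailing digits 0 of n + 1, so \<open>lev n\<close> is the
  3-adic valuation of n + 1.\<close>

lemma power_3_dvd_Suc_iff: "3 ^ J dvd Suc n \<longleftrightarrow> J \<le> lev n"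
proof (induction n arbitrary: J rule: lev.induct)
  case (1 n)
  show ?case
  proof (cases J)
    case (Suc K)
    show ?thesis
    proof (cases "n mod 3 = 2")
      case True
      have e: "Suc n = 3 * Suc (n div 3)" using True by presburger
      have l: "lev n = Suc (lev (n div 3))" using True by (subst lev.simps) simp
      have "3 ^ J dvd Suc n \<longleftrightarrow> 3 * 3 ^ K dvd 3 * Suc (n div 3)"
        by (simp only: Suc power_Suc flip: e)
      also have "\<dots> \<longleftrightarrow> 3 ^ K dvd Suc (n div 3)" by (rule nat_mult_dvd_cancel1) simp
      also have "\<dots> \<longleftrightarrow> K \<le> lev (n div 3)" by (rule 1[OF True])
      also have "\<dots> \<longleftrightarrow> J \<le> lev n" by (simp only: l Suc Suc_le_mono)
      finally show ?thesis .
    next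
      case False
      then have l: "lev n = 0" by (subst lev.simps) simp
      have "\<not> 3 dvd Suc n" using False by presburger
      then have "\<not> 3 * 3 ^ K dvd Suc n" using dvd_mult_left by blast
      then show ?thesis using l Suc by simp
    qed
  qed simp
qed

text \<open>Locates the ends of the blocks: the step into a position
  \<open>3 ^ K * (3 * t + 1)\<close> opens v_K, and the step into \<open>3 ^ K * (3 * t + 2)\<close>
  closes it.\<close>

lemma lev_step:
  assumes "Suc n = 3 ^ K * (3 * t + r)" "r = 1 \<or> r = 2"
  shows "lev n = K" "dig n K = r - 1"
proof -
  have "3 ^ K dvd Suc n" using assms by simp
  moreover have "\<not> 3 ^ Suc K dvd Suc n"
  proof
    assume "3 ^ Suc K dvd Suc n"
    then have "3 ^ K * 3 dvd 3 ^ K * (3 * t + r)" unfolding assms(1) by (simp add: mult.commute)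
    then have "3 dvd 3 * t + r" by simp
    then show False using assms(2) by presburger
  qed
  ultimately show l: "lev n = K" unfolding power_3_dvd_Suc_iff by simp
  have "dig (Suc n) K = r" using assms by (auto simp: dig_def)
  then show "dig n K = r - 1" using dig_lev[of n] l by simp
qed

text \<open>A vector assigns to each position n a formal integer combination of monomials, stored as its
coefficients on exponent functions. The operator xop is X. The operator gen i is D^i(a): on a step
that turns digit j = lev n from 0 to 1, the commutator with X contributes the factor v_j^i; on a step
that turns it from 1 to 2, a extracts the coefficient of v_j^(2^j) and the commutator contributes
(-v_j)^i.\<close>

type_synonym vec = "nat \<Rightarrow> (nat \<Rightarrow> nat) \<Rightarrow> int"

definition xop :: "vec \<Rightarrow> vec" where
  "xop f n e = (\<Sum>j\<in>opn n. if e j = 0 then 0 else f n (e(j := e j - 1)))"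

fun gen :: "nat \<Rightarrow> vec \<Rightarrow> vec" where
  "gen i f 0 e = 0"
| "gen i f (Suc n) e =
     (if dig n (lev n) = 0 then if e (lev n) = i then f n (e(lev n := 0)) else 0
      else if e (lev n) = 0 \<and> i \<le> 2 ^ lev n then (- 1) ^ i * f n (e(lev n := 2 ^ lev n - i)) else 0)"

lemma additive_xop: "Modules.additive xop"
  by standard (auto simp: fun_eq_iff xop_def sum.distrib[symmetric] intro!: sum.cong)

lemma additive_gen: "Modules.additive (gen i)"
proof
  fix f g
  have "gen i (f + g) n e = gen i f n e + gen i g n e" for n e
    by (cases n) (auto simp: algebra_simps)
  then show "gen i (f + g) = gen i f + gen i g" by (simp add: fun_eq_iff)
qed

section \<open>Commutators of the generators with X\<close>

definition adx :: "(vec \<Rightarrow> vec) \<Rightarrow> vec \<Rightarrow> vec" where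
  "adx x f = xop (x f) - x (xop f)"

text \<open>The positions before and after a step have the same open variables except v_j. All other
  summands of X cancel in the commutator. If v_j is opened, multiplication by v_j after the step
  survives; if it is closed, minus the multiplication before the step.\<close>

lemma adx_gen: "adx (gen i) = gen (Suc i)"
proof -
  have "xop (gen i f) n e - gen i (xop f) n e = gen (Suc i) f n e" for f n e
  proof (cases n)
    case 0
    then show ?thesis by (auto simp: xop_def intro!: sum.neutral)
  next
    case (Suc k)
    define j where "j = lev k"
    show ?thesis
    proof (cases "dig k j = 0")
      case True
      have j: "j \<notin> opn k" using True lev_in_opn_iff j_def by auto
      have o: "opn n = insert j (opn k)" using True opn_Suc j_def Suc by auto
      have "xop (gen i f) n e = (if e j = 0 then 0 else gen i f n (e(j := e j - 1)))
          + (\<Sum>l\<in>opn k. if e l = 0 then 0 else gen i f n (e(l := e l - 1)))"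
        unfolding xop_def o using j finite_opn by simp
      also have "(if e j = 0 then 0 else gen i f n (e(j := e j - 1))) = gen (Suc i) f n e"
        using True Suc j_def by auto
      also have "(\<Sum>l\<in>opn k. if e l = 0 then 0 else gen i f n (e(l := e l - 1))) =
         (\<Sum>l\<in>opn k. if e j = i then (if (e(j:=0)) l = 0 then 0 else f k ((e(j:=0))(l := (e(j:=0)) l - 1))) else 0)"
        using j True Suc by (intro sum.cong refl) (auto simp: j_def fun_upd_twist)
      also have "\<dots> = gen i (xop f) n e"
        using True Suc unfolding xop_def j_def by (auto simp: xop_def)
      finally show ?thesis by simp
    next
      case False
      have j: "j \<in> opn k" using False lev_in_opn_iff j_def by auto
      have o: "opn n = opn k - {j}" using False opn_Suc j_def Suc by auto
      define e' where "e' = e(j := 2 ^ j - i)"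
      define P where "P \<longleftrightarrow> e j = 0 \<and> i \<le> 2 ^ j"
      have "gen i (xop f) n e = (if P then (- 1) ^ i * xop f k e' else 0)"
        using False Suc by (simp add: P_def j_def e'_def)
      also have "xop f k e' = (if e' j = 0 then 0 else f k (e'(j := e' j - 1))) +
          (\<Sum>l\<in>opn k - {j}. if e' l = 0 then 0 else f k (e'(l := e' l - 1)))"
        unfolding xop_def by (rule sum.remove[OF finite_opn j])
      finally have 1: "gen i (xop f) n e =
         (if P then (- 1) ^ i * (if e' j = 0 then 0 else f k (e'(j := e' j - 1))) else 0) +
         (if P then (- 1) ^ i * (\<Sum>l\<in>opn k - {j}. if e' l = 0 then 0 else f k (e'(l := e' l - 1))) else 0)"
        by (simp add: algebra_simps)
      \<comment> \<open>For \<open>i = 2 ^ j\<close> both sides are 0: an exponent 0 cannot be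
        lowered, and \<open>gen (Suc i)\<close> then asks for a negative exponent.\<close>
      have 2: "(if P then (- 1) ^ i * (if e' j = 0 then 0 else f k (e'(j := e' j - 1))) else 0) = - gen (Suc i) f n e"
        using False Suc by (auto simp: P_def j_def e'_def)
      have "xop (gen i f) n e = (\<Sum>l\<in>opn k - {j}. if P then (- 1) ^ i * (if e' l = 0 then 0 else f k (e'(l := e' l - 1))) else 0)"
        unfolding xop_def o using False Suc
        by (intro sum.cong refl) (auto simp: P_def j_def e'_def fun_upd_twist)
      also have "\<dots> = (if P then (- 1) ^ i * (\<Sum>l\<in>opn k - {j}. if e' l = 0 then 0 else f k (e'(l := e' l - 1))) else 0)"
        by (simp add: sum_distrib_left)
      finally show ?thesis using 1 2 by simp
    qed
  qed
  then show ?thesis by (intro ext) (simp only: adx_def minus_apply)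
qed

section \<open>Words in the generators, and why long words with bounded letters vanish\<close>

primrec wordop :: "nat list \<Rightarrow> vec \<Rightarrow> vec" where
  "wordop [] = id"
| "wordop (i # w) = gen i \<circ> wordop w"

lemma wordop_append: "wordop (u @ w) = wordop u \<circ> wordop w"
  by (induction u) (auto simp: o_assoc)

lemma additive_wordop: "Modules.additive (wordop w)"
proof (induction w)
  case (Cons i w)
  then show ?case using additive_gen[of i] by (simp add: Modules.additive_def)
qed (simp add: Modules.additive_def)

text \<open>A generator reads only the preceding position, so words can be studied one starting
  position at a time.\<close>

lemma gen_local: "f n = (\<lambda>e. 0) \<Longrightarrow> gen i f (Suc n) = (\<lambda>e. 0)"
  by auto

lemma wordop_local:
  assumes "f n = (\<lambda>e. 0)" shows "wordop w f (n + length w) = (\<lambda>e. 0)"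
  by (induction w) (auto simp: assms intro!: gen_local)

text \<open>Nothing enters position 0, so each further letter empties one more position at the
  bottom.\<close>

lemma wordop_initial: "n < length w \<Longrightarrow> wordop w f n e = 0"
proof (induction w arbitrary: n e)
  case (Cons i w)
  show ?case
  proof (cases n)
    case (Suc k)
    then have "wordop w f k = (\<lambda>e. 0)" using Cons by auto
    then show ?thesis using Suc gen_local[of "wordop w f" k i] by (simp only: wordop.simps comp_apply)
  qed simp
qed simp

text \<open>The last letter of \<open>w\<close> acts first, and its step opens v_J with exponent
  equal to that letter. The later steps stay inside the block, where only variables below v_J are
  opened or closed.\<close>

lemma wordop_block_interior:
  assumes "set w \<subseteq> {..m}" "w \<noteq> []" "Suc b = 3 ^ J * (3 * q + 1)" "length w \<le> 3 ^ J"
    and "wordop w f (b + length w) e \<noteq> 0"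
  shows "e J \<le> m"
  using assms
proof (induction w arbitrary: e)
  case (Cons i w)
  show ?case
  proof (cases "w = []")
    case True
    have "lev b = J" "dig b J = 0" using lev_step[of b J q 1] Cons.prems(3) by auto
    moreover have "gen i f (Suc b) e \<noteq> 0" using Cons.prems(5) True by simp
    ultimately have "e J = i" unfolding gen.simps by (simp split: if_splits)
    then show ?thesis using Cons.prems(1) by simp
  next
    case False
    define n where "n = b + length w"
    \<comment> \<open>A step of level at least J would force \<open>3 ^ J\<close> to divide
      \<open>length w\<close>, which lies strictly between 0 and \<open>3 ^ J\<close>.\<close>
    have "lev n < J"
    proof (rule ccontr)
      assume "\<not> lev n < J"
      then have "3 ^ J dvd Suc n" using power_3_dvd_Suc_iff by simp
      then have "3 ^ J dvd Suc b + length w" by (simp add: n_def)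
      then have "3 ^ J dvd length w" using Cons.prems(3) by (metis dvd_add_right_iff dvd_triv_left)
      then show False using False Cons.prems(4) by (auto dest: dvd_imp_le)
    qed
    moreover have "gen i (wordop w f) (Suc n) e \<noteq> 0" using Cons.prems(5) by (simp add: n_def)
    ultimately have "\<exists>c. wordop w f n (e(lev n := c)) \<noteq> 0 \<and> (e(lev n := c)) J = e J"
      by (auto split: if_splits)
    then obtain c where "wordop w f n (e(lev n := c)) \<noteq> 0" "(e(lev n := c)) J = e J" by blast
    moreover from this(1) have "(e(lev n := c)) J \<le> m"
      using Cons.prems False by (intro Cons.IH[of "e(lev n := c)"]) (auto simp: n_def fun_upd_def)
    ultimately show ?thesis by simp
  qed
qed simp

text \<open>Opening v_J with an index at most m leaves an exponent at most m, which the matching closing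
step, asking for at least 2^J - m, does not accept.\<close>

lemma wordop_block:
  assumes "set w \<subseteq> {..m}" "Suc b = 3 ^ J * (3 * q + 1)" "length w = Suc (3 ^ J)" "2 * m < 2 ^ J"
  shows "wordop w f (b + length w) = (\<lambda>e. 0)"
proof
  fix e
  obtain i u where w: "w = i # u" using assms(3) by (cases w) auto
  have u: "length u = 3 ^ J" using w assms by simp
  have "Suc (b + length u) = 3 ^ J * (3 * q + 2)" using assms(2) u by (simp add: algebra_simps)
  from lev_step[OF this] have l: "lev (b + length u) = J" "dig (b + length u) J = 1" by auto
  have "wordop u f (b + length u) (e(J := 2 ^ J - i)) = 0"
  proof (rule ccontr)
    assume "\<not> ?thesis"
    then have "(e(J := 2 ^ J - i)) J \<le> m"
      using assms w u by (intro wordop_block_interior[of u m b J q f "e(J := 2 ^ J - i)"]) auto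
    then have "2 ^ J - i \<le> m" by (simp only: fun_upd_same)
    moreover have "i \<le> m" using assms(1) w by simp
    ultimately show False using assms(4) by linarith
  qed
  then show "wordop w f (b + length w) e = 0" using w l by simp
qed

lemma wordop_eq_0:
  assumes "set w \<subseteq> {..m}" "2 * m < 2 ^ J" "length w \<ge> 6 * 3 ^ J + 1"
  shows "wordop w = 0"
proof -
  have "wordop w f p e = 0" for f p e
  proof (cases "p < length w")
    case True
    then show ?thesis by (rule wordop_initial)
  next
    case False
    define s where "s = p - length w"
    \<comment> \<open>With this \<open>q\<close> the block of v_J starts after \<open>s\<close>, but
      by less than two periods \<open>3 * 3 ^ J\<close>; the length \<open>6 * 3 ^ J + 1\<close>
      therefore leaves room to traverse it before reaching \<open>p\<close>.\<close>
    define q where "q = Suc (s div (3 * 3 ^ J))"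
    define b where "b = 3 ^ J * (3 * q + 1) - 1"
    have b: "Suc b = 3 ^ J * (3 * q + 1)" unfolding b_def by simp
    have 1: "s < 3 * 3 ^ J * q" unfolding q_def by (metis dividend_less_times_div mult_Suc_right add.commute zero_less_numeral zero_less_power mult_pos_pos)
    have 2: "3 * 3 ^ J * q \<le> s + 3 * 3 ^ J" unfolding q_def by (simp add: algebra_simps) (metis div_times_less_eq_dividend mult.commute mult.assoc)
    have sb: "s \<le> b" and bp: "b + Suc (3 ^ J) \<le> p"
      using 1 2 b False assms(3) by (auto simp: s_def algebra_simps)
    \<comment> \<open>Letters on the right act first: \<open>w3\<close> leads from \<open>s\<close>
      to \<open>b\<close>, \<open>w2\<close> through the block including its opening and closing
      steps, and \<open>w1\<close> on to \<open>p\<close>.\<close>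
    define w1 where "w1 = take (p - (b + Suc (3 ^ J))) w"
    define w2 where "w2 = take (Suc (3 ^ J)) (drop (length w1) w)"
    define w3 where "w3 = drop (Suc (3 ^ J)) (drop (length w1) w)"
    have l1: "length w1 = p - (b + Suc (3 ^ J))" using sb bp s_def False by (simp add: w1_def)
    have l2: "length w2 = Suc (3 ^ J)" using l1 sb bp s_def False by (simp add: w2_def)
    have "drop (length w1) w = w2 @ w3" unfolding w2_def w3_def by (rule append_take_drop_id [symmetric])
    moreover have "w = w1 @ drop (length w1) w" unfolding l1 by (simp add: w1_def)
    ultimately have w: "w = w1 @ w2 @ w3" by simp
    have "set w2 \<subseteq> {..m}" using assms(1) w by auto
    from wordop_block[OF this b l2 assms(2)]
    have "wordop w2 (wordop w3 f) (b + length w2) = (\<lambda>e. 0)" .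
    from wordop_local[of "wordop w2 (wordop w3 f)" "b + length w2" w1, OF this]
    have "wordop w f (b + length w2 + length w1) = (\<lambda>e. 0)" by (simp add: w wordop_append)
    moreover have "b + length w2 + length w1 = p" using l1 l2 bp by simp
    ultimately show ?thesis by simp
  qed
  then show ?thesis by (simp add: fun_eq_iff)
qed

section \<open>Additive subgroups generated by a set\<close>

text \<open>The rules add or subtract a single generator, so that inductions only have to treat one
  generator at a time.\<close>

inductive_set zspan :: "'a::ab_group_add set \<Rightarrow> 'a set" for S where
  zero: "0 \<in> zspan S"
| add: "x \<in> S \<Longrightarrow> y \<in> zspan S \<Longrightarrow> x + y \<in> zspan S"
| diff: "x \<in> S \<Longrightarrow> y \<in> zspan S \<Longrightarrow> y - x \<in> zspan S"

lemma zspan_plus: "x \<in> zspan S \<Longrightarrow> y \<in> zspan S \<Longrightarrow> x + y \<in> zspan S"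
proof (induction rule: zspan.induct)
  case (diff u v)
  then have "(v + y) - u \<in> zspan S" by (intro zspan.diff)
  then show ?case by (simp add: algebra_simps)
qed (auto simp: add.assoc intro: zspan.add)

lemma zspan_uminus: "x \<in> zspan S \<Longrightarrow> - x \<in> zspan S"
proof (induction rule: zspan.induct)
  case (add u v)
  then show ?case using zspan.diff[of u S "- v"] by (simp add: minus_diff_commute)
next
  case (diff u v)
  then show ?case using zspan.add[of u S "- v"] by (simp add: algebra_simps)
qed (auto intro: zspan.zero)

lemma zspan_incl: "x \<in> S \<Longrightarrow> x \<in> zspan S"
  using zspan.add[OF _ zspan.zero] by fastforce

lemma zspan_minimal:
  assumes "0 \<in> T" "\<And>x y. x \<in> T \<Longrightarrow> y \<in> T \<Longrightarrow> x + y \<in> T" "\<And>x. x \<in> T \<Longrightarrow> - x \<in> T" "S \<subseteq> T"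
  shows "zspan S \<subseteq> T"
proof
  fix x assume "x \<in> zspan S"
  then show "x \<in> T"
  proof induction
    case (diff x y)
    then have "y + - x \<in> T" using assms by blast
    then show ?case by simp
  qed (use assms in auto)
qed

lemma zspan_mono: "S \<subseteq> T \<Longrightarrow> zspan S \<subseteq> zspan T"
  by (rule zspan_minimal) (auto intro: zspan.zero zspan_plus zspan_uminus zspan_incl)

text \<open>Every element is the sum of a finite list of generators and negated generators.
  Countability is what allows R to be encoded in the type \<open>nat set\<close>.\<close>

lemma countable_zspan:
  assumes "countable S" shows "countable (zspan S)"
proof -
  have "x \<in> sum_list ` lists (S \<union> uminus ` S)" if "x \<in> zspan S" for x
    using that
  proof induction
    case zero
    then show ?case by (intro image_eqI[of _ _ "[]"]) auto
  next
    case (add x y)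
    then obtain l where "y = sum_list l" "l \<in> lists (S \<union> uminus ` S)" by auto
    then show ?case using add by (intro image_eqI[of _ _ "x # l"]) auto
  next
    case (diff x y)
    then obtain l where "y = sum_list l" "l \<in> lists (S \<union> uminus ` S)" by auto
    then show ?case using diff by (intro image_eqI[of _ _ "- x # l"]) auto
  qed
  then have "zspan S \<subseteq> sum_list ` lists (S \<union> uminus ` S)" by auto
  moreover have "countable (lists (S \<union> uminus ` S))" using assms by auto
  ultimately show ?thesis by (meson countable_image countable_subset)
qed

text \<open>Composition always distributes over sums in the left factor, but in the right factor
  only if the left one is additive. Hence a single generator on the left is treated first.\<close>

lemma zspan_comp:
  fixes S T U :: "('v::ab_group_add \<Rightarrow> 'v) set"
  assumes add: "\<And>x. x \<in> S \<Longrightarrow> Modules.additive x"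
    and ST: "\<And>x y. x \<in> S \<Longrightarrow> y \<in> T \<Longrightarrow> x \<circ> y \<in> U"
    and xS: "x \<in> zspan S" and "y \<in> zspan T"
  shows "x \<circ> y \<in> zspan U"
proof -
  have 1: "x \<circ> y \<in> zspan U" if x: "x \<in> S" and "y \<in> zspan T" for x y
    using that(2)
  proof induction
    case zero
    have "x \<circ> (0 :: 'v \<Rightarrow> 'v) = 0" by (simp add: fun_eq_iff Modules.additive.zero[OF add[OF x]])
    then show ?case by (simp only: zspan.zero)
  next
    case (add u v)
    have "x \<circ> (u + v) = (x \<circ> u) + (x \<circ> v)"
      by (simp add: fun_eq_iff Modules.additive.add[OF assms(1)[OF x]])
    then show ?case by (simp only: zspan_plus zspan_incl ST x add)
  next
    case (diff u v)
    have "x \<circ> (v - u) = (x \<circ> v) + - (x \<circ> u)"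
      by (simp add: fun_eq_iff Modules.additive.diff[OF assms(1)[OF x]])
    then show ?case by (simp only: zspan_plus zspan_uminus zspan_incl ST x diff)
  qed
  show ?thesis
    using assms(3)
  proof induction
    case zero
    have "(0 :: 'v \<Rightarrow> 'v) \<circ> y = 0" by (simp add: fun_eq_iff)
    then show ?case by (simp only: zspan.zero)
  next
    case (add u v)
    have "(u + v) \<circ> y = (u \<circ> y) + (v \<circ> y)" by (simp add: fun_eq_iff)
    then show ?case by (simp only: zspan_plus 1 assms(4) add)
  next
    case (diff u v)
    have "(v - u) \<circ> y = (v \<circ> y) + - (u \<circ> y)" by (simp add: fun_eq_iff)
    then show ?case by (simp only: zspan_plus zspan_uminus 1 assms(4) diff)
  qed
qed

section \<open>The ring R of operators and the powers of its subrings with bounded letters\<close>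

text \<open>For d at least 1 this is the d-th power of the ring generated by x_0, ..., x_m.\<close>

definition wspan :: "nat \<Rightarrow> nat \<Rightarrow> (vec \<Rightarrow> vec) set" where
  "wspan m d = zspan {wordop w |w. set w \<subseteq> {..m} \<and> d \<le> length w}"

text \<open>The ring R. The empty word is left out because it is the identity operator, which is not
  nilpotent.\<close>

definition wring :: "(vec \<Rightarrow> vec) set" where
  "wring = zspan {wordop w |w. w \<noteq> []}"

lemma wspan_comp:
  assumes "x \<in> wspan m c" "y \<in> wspan m d" shows "x \<circ> y \<in> wspan m (c + d)"
  unfolding wspan_def
proof (rule zspan_comp[OF _ _ assms[unfolded wspan_def]])
  fix x y assume "x \<in> {wordop w |w. set w \<subseteq> {..m} \<and> c \<le> length w}"
    "y \<in> {wordop w |w. set w \<subseteq> {..m} \<and> d \<le> length w}"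
  then obtain u v where "x = wordop u" "y = wordop v" "set u \<subseteq> {..m}" "set v \<subseteq> {..m}"
    "c \<le> length u" "d \<le> length v" by auto
  then show "x \<circ> y \<in> {wordop w |w. set w \<subseteq> {..m} \<and> c + d \<le> length w}"
    by (auto simp: wordop_append[symmetric] intro!: exI[of _ "u @ v"])
qed (auto intro: additive_wordop)

lemma wring_comp:
  assumes "x \<in> wring" "y \<in> wring" shows "x \<circ> y \<in> wring"
  unfolding wring_def
proof (rule zspan_comp[OF _ _ assms[unfolded wring_def]])
  fix x y assume "x \<in> {wordop w |w. w \<noteq> []}" "y \<in> {wordop w |w. w \<noteq> []}"
  then obtain u v where "x = wordop u" "y = wordop v" "u \<noteq> []" by auto
  then show "x \<circ> y \<in> {wordop w |w. w \<noteq> []}"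
    by (auto simp: wordop_append[symmetric] intro!: exI[of _ "u @ v"])
qed (auto intro: additive_wordop)

lemma wordop_mem_wring: "w \<noteq> [] \<Longrightarrow> wordop w \<in> wring"
  unfolding wring_def by (rule zspan_incl) blast

lemma zero_mem_wring: "0 \<in> wring" and plus_mem_wring: "x \<in> wring \<Longrightarrow> y \<in> wring \<Longrightarrow> x + y \<in> wring"
  and uminus_mem_wring: "x \<in> wring \<Longrightarrow> - x \<in> wring"
  by (auto simp: wring_def intro: zspan.zero zspan_plus zspan_uminus)

lemma additive_wring: "x \<in> wring \<Longrightarrow> Modules.additive x"
  unfolding wring_def
proof -
  have "zspan {wordop w |w. w \<noteq> []} \<subseteq> Collect Modules.additive"
    by (rule zspan_minimal) (auto simp: Modules.additive_def algebra_simps additive_wordop[unfolded Modules.additive_def])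
  then show "x \<in> zspan {wordop w |w. w \<noteq> []} \<Longrightarrow> Modules.additive x" by auto
qed

lemma countable_wring: "countable wring"
  unfolding wring_def
proof (rule countable_zspan)
  have "{wordop w |w. w \<noteq> []} \<subseteq> range wordop" by auto
  then show "countable {wordop w |w. w \<noteq> []}" by (meson countableI_type countable_image countable_subset)
qed

lemma wspan_mono: "m \<le> m' \<Longrightarrow> wspan m d \<subseteq> wspan m' d"
  unfolding wspan_def by (rule zspan_mono) force

text \<open>An element of R involves finitely many letters. The sets \<open>wspan m 1\<close>
  increase with \<open>m\<close>, so their union is closed under addition.\<close>

lemma wring_eq_Union: "x \<in> wring \<Longrightarrow> \<exists>m. x \<in> wspan m 1"
proof -
  have "zspan {wordop w |w. w \<noteq> []} \<subseteq> (\<Union>m. wspan m 1)"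
  proof (rule zspan_minimal)
    show "0 \<in> (\<Union>m. wspan m 1)" by (auto simp: wspan_def intro: zspan.zero)
    fix x assume x: "x \<in> (\<Union>m. wspan m 1)"
    then show "- x \<in> (\<Union>m. wspan m 1)" by (auto simp: wspan_def intro: zspan_uminus)
    fix y assume "y \<in> (\<Union>m. wspan m 1)"
    with x obtain k l where "x \<in> wspan k 1" "y \<in> wspan l 1" by auto
    then have "x \<in> wspan (max k l) 1" "y \<in> wspan (max k l) 1"
      using wspan_mono by (meson max.cobounded1 max.cobounded2 subsetD)+
    then have "x + y \<in> wspan (max k l) 1" unfolding wspan_def by (rule zspan_plus)
    then show "x + y \<in> (\<Union>m. wspan m 1)" by blast
  next
    show "{wordop w |w. w \<noteq> []} \<subseteq> (\<Union>m. wspan m 1)"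
    proof clarify
      fix w :: "nat list" assume "w \<noteq> []"
      then have "wordop w \<in> wspan (Max (set w)) 1"
        unfolding wspan_def by (intro zspan_incl) (auto simp: Suc_le_eq)
      then show "wordop w \<in> (\<Union>m. wspan m 1)" by blast
    qed
  qed
  then show "x \<in> wring \<Longrightarrow> \<exists>m. x \<in> wspan m 1" unfolding wring_def by blast
qed

text \<open>Local nilpotency in operator form: once \<open>2 ^ J\<close> exceeds
  \<open>2 * m\<close>, all sufficiently long words vanish.\<close>

lemma wspan_eventually_zero: "\<exists>N>0. wspan m N = {0}"
proof -
  obtain J where J: "2 * m < 2 ^ J" using less_exp by blast
  have "wspan m (6 * 3 ^ J + 1) \<subseteq> {0}"
    unfolding wspan_def by (rule zspan_minimal) (use wordop_eq_0[OF _ J] in auto)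
  moreover have "0 \<in> wspan m (6 * 3 ^ J + 1)" by (simp add: wspan_def zspan.zero)
  ultimately show ?thesis by (intro exI[of _ "6 * 3 ^ J + 1"]) auto
qed

section \<open>The commutator with X as a derivation of R\<close>

lemma adx_zero: "adx 0 = 0"
  by (rule ext) (simp add: adx_def Modules.additive.zero[OF additive_xop])

lemma adx_uminus: "adx (- x) = - adx x"
  by (rule ext) (simp add: adx_def Modules.additive.minus[OF additive_xop])

lemma adx_add: "adx (x + y) = adx x + adx y"
  by (rule ext) (simp add: adx_def Modules.additive.add[OF additive_xop])

text \<open>The two middle terms x X y cancel; additivity splits \<open>x\<close> over the
  difference in \<open>adx y\<close>.\<close>

lemma adx_comp: "Modules.additive x \<Longrightarrow> adx (x \<circ> y) = (adx x \<circ> y) + (x \<circ> adx y)"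
  by (rule ext) (simp add: adx_def Modules.additive.diff)

text \<open>Leibniz rule on the first letter, with D(x_i) = x_(i+1). The empty word is the identity
  and commutes with X.\<close>

lemma adx_wordop_mem_wring: "adx (wordop w) \<in> wring"
proof (induction w)
  case Nil
  have "adx (wordop []) = 0" by (rule ext) (simp add: adx_def)
  then show ?case by (simp only: zero_mem_wring)
next
  case (Cons i w)
  have "adx (wordop (i # w)) = wordop (Suc i # w) + (wordop [i] \<circ> adx (wordop w))"
    by (simp only: wordop.simps adx_comp[OF additive_gen] adx_gen comp_id)
  then show ?case
    by (simp only: plus_mem_wring wring_comp Cons.IH wordop_mem_wring list.distinct not_False_eq_True)
qed

lemma adx_mem_wring: "x \<in> wring \<Longrightarrow> adx x \<in> wring"
proof -
  have "wring \<subseteq> adx -` wring"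
    unfolding wring_def
  proof (rule zspan_minimal, fold wring_def)
    show "{wordop w |w. w \<noteq> []} \<subseteq> adx -` wring" using adx_wordop_mem_wring by blast
  qed (simp_all only: vimage_eq adx_zero adx_add adx_uminus zero_mem_wring plus_mem_wring uminus_mem_wring)
  then show "x \<in> wring \<Longrightarrow> adx x \<in> wring" by blast
qed

section \<open>Operators that move positions up by a bounded amount\<close>

text \<open>The bound \<open>d\<close> is uniform in \<open>f\<close> and \<open>s\<close>. All
  polynomials in X with coefficients in R have this property, whereas a quasi-inverse of aX cannot
  have it.\<close>

definition bounded_shift :: "(vec \<Rightarrow> vec) \<Rightarrow> bool" where
  "bounded_shift x \<longleftrightarrow> (\<exists>d. \<forall>f s. (\<forall>n>s. f n = 0) \<longrightarrow> (\<forall>n>s + d. x f n = 0))"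

lemma bounded_shift_comp:
  assumes "bounded_shift x" "bounded_shift y" shows "bounded_shift (x \<circ> y)"
proof -
  obtain c d where "\<And>f s n. (\<forall>n>s. f n = 0) \<Longrightarrow> n > s + c \<Longrightarrow> x f n = 0"
    "\<And>f s n. (\<forall>n>s. f n = 0) \<Longrightarrow> n > s + d \<Longrightarrow> y f n = 0"
    using assms unfolding bounded_shift_def by metis
  then have "\<forall>n>s + d + c. x (y f) n = 0" if "\<forall>n>s. f n = 0" for f s using that by blast
  then show ?thesis unfolding bounded_shift_def
    by (intro exI[of _ "d + c"]) (simp add: add.assoc)
qed

lemma bounded_shift_add:
  assumes "bounded_shift x" "bounded_shift y" shows "bounded_shift (x + y)"
proof -
  obtain c d where "\<And>f s n. (\<forall>n>s. f n = 0) \<Longrightarrow> n > s + c \<Longrightarrow> x f n = 0"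
    "\<And>f s n. (\<forall>n>s. f n = 0) \<Longrightarrow> n > s + d \<Longrightarrow> y f n = 0"
    using assms unfolding bounded_shift_def by metis
  then show ?thesis unfolding bounded_shift_def
    by (intro exI[of _ "d + c"]) auto
qed

lemma bounded_shift_uminus: "bounded_shift x \<Longrightarrow> bounded_shift (- x)"
  unfolding bounded_shift_def by auto

lemma bounded_shift_zero: "bounded_shift 0"
  unfolding bounded_shift_def by auto

lemma bounded_shift_id: "bounded_shift id"
  unfolding bounded_shift_def by (intro exI[of _ 0]) auto

lemma bounded_shift_sum:
  "(\<And>i. i \<in> I \<Longrightarrow> bounded_shift (x i)) \<Longrightarrow> bounded_shift (\<Sum>i\<in>I. x i)"
  by (induction I rule: infinite_finite_induct) (auto intro: bounded_shift_zero bounded_shift_add)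

lemma bounded_shift_xop: "bounded_shift xop"
  unfolding bounded_shift_def
  by (intro exI[of _ 0]) (auto simp: fun_eq_iff xop_def intro!: sum.neutral)

lemma bounded_shift_gen: "bounded_shift (gen i)"
  unfolding bounded_shift_def
proof (intro exI[of _ 1] allI impI)
  fix f :: vec and s n assume *: "\<forall>n>s. f n = 0" "s + 1 < n"
  then obtain k where "n = Suc k" "k > s" by (cases n) auto
  then show "gen i f n = 0" using * gen_local[of f k i] by (simp add: zero_fun_def)
qed

lemma bounded_shift_wordop: "bounded_shift (wordop w)"
  by (induction w)
    (simp_all only: wordop.simps bounded_shift_id bounded_shift_comp bounded_shift_gen)

lemma bounded_shift_wring: "x \<in> wring \<Longrightarrow> bounded_shift x"
proof -
  have "wring \<subseteq> Collect bounded_shift" unfolding wring_def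
    by (rule zspan_minimal)
      (auto intro: bounded_shift_zero bounded_shift_add bounded_shift_uminus bounded_shift_wordop)
  then show "x \<in> wring \<Longrightarrow> bounded_shift x" by auto
qed

lemma bounded_shift_funpow: "bounded_shift x \<Longrightarrow> bounded_shift (x ^^ n)"
  by (induction n) (auto intro: bounded_shift_id bounded_shift_comp)

section \<open>Arbitrarily high powers of aX do not vanish\<close>

text \<open>X and a = \<open>gen 0\<close> involve no signs, so on nonnegative vectors nothing
  cancels, and it suffices to follow one favourable path of monomials.\<close>

definition nonneg :: "vec \<Rightarrow> bool" where
  "nonneg f \<longleftrightarrow> (\<forall>n e. 0 \<le> f n e)"

lemma nonneg_xop: "nonneg f \<Longrightarrow> nonneg (xop f)"
  by (auto simp: nonneg_def xop_def intro!: sum_nonneg)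

lemma nonneg_gen_0: "nonneg f \<Longrightarrow> nonneg (gen 0 f)"
  unfolding nonneg_def
proof (intro allI)
  fix n e assume "\<forall>n e. 0 \<le> f n e"
  then show "0 \<le> gen 0 f n e" by (cases n) auto
qed

lemma nonneg_funpow: "nonneg f \<Longrightarrow> nonneg (((gen 0 \<circ> xop) ^^ k) f)"
  by (induction k) (auto intro: nonneg_xop nonneg_gen_0)

lemma xop_pos:
  assumes "nonneg f" "f n e > 0" "l \<in> opn n" shows "xop f n (e(l := Suc (e l))) > 0"
proof -
  let ?e = "e(l := Suc (e l))"
  have "xop f n ?e \<ge> (\<Sum>j\<in>{l}. if ?e j = 0 then 0 else f n (?e(j := ?e j - 1)))"
    unfolding xop_def using assms finite_opn by (intro sum_mono2) (auto simp: nonneg_def)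
  then show ?thesis using assms by simp
qed

lemma gen_0_push: "lev n = K \<Longrightarrow> dig n K = 0 \<Longrightarrow> e K = 0 \<Longrightarrow> gen 0 g (Suc n) e = g n e"
  by (auto simp: fun_upd_idem)

lemma gen_0_pop: "lev n = K \<Longrightarrow> dig n K \<noteq> 0 \<Longrightarrow> e K = 0 \<Longrightarrow> gen 0 g (Suc n) e = g n (e(K := 2 ^ K))"
  by auto

text \<open>Induction on K by thirds. The first third raises the exponent of v_l by
  \<open>2 ^ K\<close>. Then v_K is opened, gains \<open>2 ^ K\<close> during the middle third, and
  is closed at exactly this exponent. The last third gives v_l another \<open>2 ^ K\<close>. The
  final X stands outside the power because the step that would follow lies beyond the run.\<close>

lemma run_pos:
  assumes "nonneg f" "s = 3 ^ K * t" "l \<in> opn s" "\<forall>j<K. e j = 0" "f s e > 0"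
  shows "xop (((gen 0 \<circ> xop) ^^ (3 ^ K - 1)) f) (s + (3 ^ K - 1)) (e(l := e l + 2 ^ K)) > 0"
  using assms
proof (induction K arbitrary: f s t e l)
  case 0
  then show ?case using xop_pos[of f s e l] by (simp add: fun_upd_def)
next
  case (Suc K)
  define Z where "Z = gen 0 \<circ> xop"
  have Z_apply: "Z g = gen 0 (xop g)" for g by (simp add: Z_def)
  define k where "k = (3::nat) ^ K - 1"
  have k: "3 ^ K = Suc k" by (simp add: k_def)
  \<comment> \<open>The digits of \<open>s\<close> up to place \<open>K\<close> are 0, so the open
    variable v_l lies above v_K.\<close>
  have lK: "K < l"
  proof (rule ccontr)
    assume "\<not> K < l"
    then have "3 ^ Suc l dvd s" unfolding Suc.prems(2) by (intro dvd_mult2 le_imp_power_dvd) simp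
    then obtain c where "s = 3 ^ l * (3 * c)" by (auto simp: dvd_def ac_simps)
    then show False using Suc.prems(3) by (simp add: opn_def dig_def)
  qed
  have st1: "Suc (s + k) = 3 ^ K * (3 * t + 1)" and st2: "Suc (s + Suc k + k) = 3 ^ K * (3 * t + 2)"
    using Suc.prems(2) k by (auto simp: algebra_simps)
  note l1 = lev_step[OF st1] and l2 = lev_step[OF st2]
  \<comment> \<open>Throughout the run v_l stays open: its digit depends only on the quotient by
    \<open>3 ^ Suc K\<close>, which does not change.\<close>
  have dl: "dig (s + c) l = dig s l" if "c < 3 ^ Suc K" for c
  proof -
    have "3 ^ l = 3 ^ Suc K * (3::nat) ^ (l - Suc K)" using lK by (metis Suc_leI le_add_diff_inverse power_add)
    moreover have "(s + c) div 3 ^ Suc K = s div 3 ^ Suc K" using that Suc.prems(2) by simp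
    ultimately show ?thesis unfolding dig_def by (metis div_mult2_eq)
  qed
  have "3 ^ Suc K = 3 * Suc k" using k by simp
  then have ls2: "l \<in> opn (s + Suc k + Suc k)"
    using dl[of "Suc k + Suc k"] Suc.prems(3) by (simp add: opn_def add.assoc)
  have "dig (Suc (s + k)) K = 1" using dig_lev[of "s + k"] l1 by simp
  then have Ks: "K \<in> opn (s + Suc k)" by (simp add: opn_def)
  have IH: "xop ((Z ^^ k) f) (s + k) (e(l := e l + 2 ^ K)) > 0"
    if "nonneg f" "s = 3 ^ K * t" "l \<in> opn s" "\<forall>j<K. e j = 0" "f s e > 0" for f s t l e
    unfolding Z_def k_def using Suc.IH[of f s t l e] that by blast
  define f1 where "f1 = Z ((Z ^^ k) f)"
  define f2 where "f2 = Z ((Z ^^ k) f1)"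
  have nn: "nonneg f1" "nonneg f2"
    using nonneg_funpow[OF Suc.prems(1), of "Suc k"] nonneg_funpow[of f1 "Suc k"]
    by (auto simp: f1_def f2_def Z_def)
  define e1 where "e1 = e(l := e l + 2 ^ K)"
  have e1_0: "\<forall>j<K. e1 j = 0" "e1 K = 0" using Suc.prems(4) lK by (simp_all add: e1_def)
  have s0: "s = 3 ^ K * (3 * t)" and s1: "s + Suc k = 3 ^ K * (3 * t + 1)"
    and s2: "s + Suc k + Suc k = 3 ^ K * (3 * t + 2)"
    using st1 st2 Suc.prems(2) by simp_all
  have e0: "\<forall>j<K. e j = 0" using Suc.prems(4) by simp
  have "xop ((Z ^^ k) f) (s + k) e1 > 0"
    unfolding e1_def by (rule IH[of f s "3 * t" l e, OF Suc.prems(1) s0 Suc.prems(3) e0 Suc.prems(5)])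
  then have p1: "f1 (s + Suc k) e1 > 0"
    using gen_0_push[OF l1(1), of e1] l1(2) e1_0 by (simp only: f1_def Z_apply add_Suc_right) simp
  \<comment> \<open>In the middle third \<open>K\<close> itself plays the role of \<open>l\<close>.
    The closing step then consumes the gained exponent, which restores the monomial
    \<open>e1\<close>.\<close>
  have "xop ((Z ^^ k) f1) (s + Suc k + k) (e1(K := e1 K + 2 ^ K)) > 0"
    by (rule IH[of f1 "s + Suc k" "3 * t + 1" K e1, OF nn(1) s1 Ks e1_0(1) p1])
  then have p2: "f2 (s + Suc k + Suc k) e1 > 0"
    using gen_0_pop[OF l2(1), of e1] l2(2) e1_0 by (simp only: f2_def Z_apply add_Suc_right) simp
  have "xop ((Z ^^ k) f2) (s + Suc k + Suc k + k) (e1(l := e1 l + 2 ^ K)) > 0"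
    by (rule IH[of f2 "s + Suc k + Suc k" "3 * t + 2" l e1, OF nn(2) s2 ls2 e1_0(1) p2])
  moreover have k3: "3 ^ Suc K - 1 = k + Suc k + Suc k" using k by simp
  then have "(Z ^^ k) f2 = (Z ^^ (3 ^ Suc K - 1)) f"
    unfolding k3 funpow_add by (simp only: f1_def f2_def comp_apply funpow.simps)
  moreover have "s + Suc k + Suc k + k = s + (3 ^ Suc K - 1)" using k3 by simp
  moreover have "e1(l := e1 l + 2 ^ K) = e(l := e l + 2 ^ Suc K)" by (simp add: e1_def mult_2 add.assoc)
  ultimately show ?case unfolding Z_def by (simp only:)
qed

text \<open>The vector \<open>f\<close> is the monomial 1 at the first position of a block of v_K.
  Across the block v_K reaches the exponent \<open>2 ^ K\<close>, so the closing step returns the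
  monomial 1.\<close>

lemma funpow_pos:
  fixes K :: nat
  defines "f \<equiv> \<lambda>n e. if n = 3 ^ K \<and> e = (\<lambda>_. 0) then 1 else 0"
  shows "((gen 0 \<circ> xop) ^^ 3 ^ K) f (2 * 3 ^ K) (\<lambda>_. 0) > 0"
proof -
  define Z where "Z = gen 0 \<circ> xop"
  have Z_apply: "Z g = gen 0 (xop g)" for g by (simp add: Z_def)
  define k where "k = (3::nat) ^ K - 1"
  have k: "3 ^ K = Suc k" by (simp add: k_def)
  have "nonneg f" by (simp add: nonneg_def f_def)
  then have 1: "xop ((Z ^^ k) f) (3 ^ K + k) ((\<lambda>_. 0)(K := 0 + 2 ^ K)) > 0"
    using run_pos[of f "3 ^ K" K 1 K "\<lambda>_. 0"]
    by (simp add: opn_def dig_def f_def Z_def k_def)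
  have s: "Suc (3 ^ K + k) = 3 ^ K * (3 * 0 + 2)" using k by simp
  have "gen 0 (xop ((Z ^^ k) f)) (Suc (3 ^ K + k)) (\<lambda>_. 0) > 0"
    using 1 gen_0_pop[of "3 ^ K + k" K "\<lambda>_. 0" "xop ((Z ^^ k) f)"]
      lev_step[OF s] by (simp only: add_0) simp
  moreover have "gen 0 (xop ((Z ^^ k) f)) = (Z ^^ 3 ^ K) f"
    unfolding k by (simp only: funpow.simps comp_apply Z_apply)
  moreover have "Suc (3 ^ K + k) = 2 * 3 ^ K" using s by simp
  ultimately show ?thesis unfolding Z_def by (simp only:)
qed

lemma gen_xop_local: "g n = h n \<Longrightarrow> gen i (xop g) (Suc n) = gen i (xop h) (Suc n)"
proof -
  assume "g n = h n"
  then have "xop g n = xop h n" by (intro ext) (simp only: xop_def)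
  then show ?thesis by (simp add: fun_eq_iff)
qed

text \<open>An operator y with (1 - aX)(1 - y) = 1 would be minus the sum of all powers (aX)^k, k > 0,
whose shifts are unbounded.\<close>

lemma not_quasi_inverse:
  assumes "bounded_shift y" shows "\<exists>f. gen 0 (xop f) + y f \<noteq> gen 0 (xop (y f))"
proof (rule ccontr)
  assume "\<not> ?thesis"
  then have eq: "gen 0 (xop f) + y f = gen 0 (xop (y f))" for f by blast
  obtain d where d: "\<And>f s n. (\<forall>n>s. f n = 0) \<Longrightarrow> n > s + d \<Longrightarrow> y f n = 0"
    using assms unfolding bounded_shift_def by metis
  \<comment> \<open>A block starting at \<open>3 ^ d\<close> has length \<open>3 ^ d\<close>, more
    than the shift \<open>d\<close> allowed to \<open>y\<close>.\<close>
  define s where "s = (3::nat) ^ d"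
  define f :: vec where "f = (\<lambda>n e. if n = s \<and> e = (\<lambda>_. 0) then 1 else 0)"
  define Z where "Z = gen 0 \<circ> xop"
  define h where "h = f - y f"
  have ds: "d < s" unfolding s_def using less_le_trans[OF less_exp[of d] power_mono[of 2 "3::nat" d]] by simp
  have Zdiff: "Z (u - v) = Z u - Z v" for u v
    by (simp add: Z_def Modules.additive.diff[OF additive_xop] Modules.additive.diff[OF additive_gen])
  \<comment> \<open>The quasi-inverse equation becomes a recursion that determines \<open>h\<close>
    position by position, since \<open>Z\<close> reads only the preceding position.\<close>
  have "h = f + Z h" unfolding h_def Zdiff using eq[of f] by (simp add: Z_def algebra_simps)
  then have h: "h n = f n + Z h n" for n by (metis plus_fun_apply)
  have f0: "f n = 0" if "n \<noteq> s" for n using that by (simp add: f_def zero_fun_def)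
  have Z0: "Z g 0 = 0" for g by (simp add: Z_def fun_eq_iff)
  have Zloc: "Z g (Suc n) = Z g' (Suc n)" if "g n = g' n" for g g' n
    using gen_xop_local[where g = g and h = g' and n = n, OF that] by (simp add: Z_def)
  have ZZ: "Z 0 = 0" using Zdiff[of 0 0] by simp
  have h0: "h n = 0" if "n < s" for n
    using that
  proof (induction n)
    case 0
    then show ?case using h[of 0] f0 Z0 by simp
  next
    case (Suc n)
    then have "Z h (Suc n) = Z 0 (Suc n)" by (intro Zloc) (simp add: zero_fun_def)
    then show ?case using h[of "Suc n"] f0 ZZ Suc by simp
  qed
  have hs: "h s = f s"
  proof (cases s)
    case 0
    then show ?thesis using h[of s] Z0 by simp
  next
    case (Suc n)
    then have "Z h (Suc n) = Z 0 (Suc n)" using h0[of n] by (intro Zloc) (simp add: zero_fun_def)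
    then show ?thesis using h[of s] ZZ Suc by simp
  qed
  \<comment> \<open>As \<open>f\<close> lives at \<open>s\<close> alone, each position of the
    geometric series sees just one power of \<open>Z\<close>.\<close>
  have "h (s + k) = (Z ^^ k) f (s + k)" for k
  proof (induction k)
    case (Suc k)
    then have "Z h (s + Suc k) = Z ((Z ^^ k) f) (s + Suc k)"
      unfolding add_Suc_right by (rule Zloc)
    then show ?case using h[of "s + Suc k"] f0 by simp
  qed (simp add: hs)
  then have "h (s + s) (\<lambda>_. 0) > 0" using funpow_pos[of d] unfolding Z_def f_def s_def by (simp only: mult_2)
  moreover have "y f (s + s) = 0" using d[of s f "s + s"] f0 ds by auto
  moreover have "f (s + s) = 0" using f0 ds by simp
  ultimately show False by (simp add: h_def)
qed

section \<open>Transport of R to the type \<open>nat set\<close>, and its ring-theoretic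
  properties\<close>

text \<open>R is countable, so an operator can be coded by the singleton of its index in an
  enumeration of \<open>wring\<close>.\<close>

definition enc :: "(vec \<Rightarrow> vec) \<Rightarrow> nat set" where
  "enc x = {to_nat_on wring x}"

definition dec :: "nat set \<Rightarrow> vec \<Rightarrow> vec" where
  "dec S = from_nat_into wring (the_elem S)"

lemma dec_enc [simp]: "x \<in> wring \<Longrightarrow> dec (enc x) = x"
  by (simp add: dec_def enc_def countable_wring)

lemma enc_eq_iff: "x \<in> wring \<Longrightarrow> y \<in> wring \<Longrightarrow> enc x = enc y \<longleftrightarrow> x = y"
  by (metis dec_enc)

definition wring_enc :: "nat set ring" where
  "wring_enc = \<lparr>carrier = enc ` wring, monoid.mult = (\<lambda>S T. enc (dec S \<circ> dec T)),
     one = undefined, zero = enc 0, add = (\<lambda>S T. enc (dec S + dec T))\<rparr>"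

definition wder :: "nat set \<Rightarrow> nat set" where
  "wder S = enc (adx (dec S))"

lemma wring_enc_sel:
  "carrier wring_enc = enc ` wring" "S \<otimes>\<^bsub>wring_enc\<^esub> T = enc (dec S \<circ> dec T)"
  "\<zero>\<^bsub>wring_enc\<^esub> = enc 0" "S \<oplus>\<^bsub>wring_enc\<^esub> T = enc (dec S + dec T)"
  by (simp_all add: wring_enc_def)

lemmas wring_closed = zero_mem_wring plus_mem_wring uminus_mem_wring wring_comp adx_mem_wring

lemma abelian_group_wring_enc: "abelian_group wring_enc"
proof (rule abelian_groupI)
  fix S assume "S \<in> carrier wring_enc"
  then obtain x where x: "x \<in> wring" "S = enc x" by (auto simp: wring_enc_sel)
  show "\<exists>T\<in>carrier wring_enc. T \<oplus>\<^bsub>wring_enc\<^esub> S = \<zero>\<^bsub>wring_enc\<^esub>"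
    using x by (intro bexI[of _ "enc (- x)"]) (auto simp: wring_enc_sel wring_closed)
qed (auto simp: wring_enc_sel wring_closed add.assoc, simp_all add: add.commute)

lemma uminus_wring_enc: "x \<in> wring \<Longrightarrow> \<ominus>\<^bsub>wring_enc\<^esub> enc x = enc (- x)"
  by (rule abelian_group.minus_equality[OF abelian_group_wring_enc])
    (auto simp: wring_enc_sel wring_closed)

lemma rng_wring_enc: "rng wring_enc"
proof -
  have "x \<circ> (y + z) = (x \<circ> y) + (x \<circ> z)" if "x \<in> wring" for x y z :: "vec \<Rightarrow> vec"
    using additive_wring[OF that] by (intro ext) (simp add: Modules.additive.add)
  moreover have "(x + y) \<circ> z = (x \<circ> z) + (y \<circ> z)" for x y z :: "vec \<Rightarrow> vec"
    by (rule ext) simp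
  ultimately show ?thesis
    unfolding rng_def using abelian_group_wring_enc
    by (auto simp: wring_enc_sel wring_closed o_assoc simp del: comp_apply)
qed

lemma derivation_wder: "derivation wring_enc wder"
  unfolding derivation_def
  by (auto simp: wder_def wring_enc_sel wring_closed adx_add adx_comp additive_wring simp del: comp_apply)

lemma wspan_1_subset: "wspan m 1 \<subseteq> wring"
  unfolding wspan_def wring_def by (rule zspan_mono) auto

lemma wspan_antimono: "c \<le> d \<Longrightarrow> wspan m d \<subseteq> wspan m c"
  unfolding wspan_def by (rule zspan_mono) auto

text \<open>A product of n factors consists of words of length at least n, so it vanishes for large
  n.\<close>

lemma prodl_wspan:
  assumes "xs \<noteq> []" "set xs \<subseteq> enc ` wspan m 1"
  shows "prodl wring_enc xs \<in> enc ` wspan m (length xs)"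
  using assms
proof (induction xs rule: induct_list012)
  case (3 S T xs)
  then obtain x y where "x \<in> wspan m 1" "S = enc x" "y \<in> wspan m (length (T # xs))"
    "prodl wring_enc (T # xs) = enc y" by auto
  moreover from this have "x \<in> wring" "y \<in> wring"
    using wspan_1_subset wspan_antimono[of 1 "length (T # xs)" m] by auto
  ultimately show ?case
    using wspan_comp[of x m 1 y "length (T # xs)"] by (auto simp: wring_enc_sel)
qed auto

lemma gen_subrng_wspan:
  assumes "F \<subseteq> enc ` wspan m 1" shows "gen_subrng wring_enc F \<subseteq> enc ` wspan m 1"
proof
  fix S assume "S \<in> gen_subrng wring_enc F"
  then show "S \<in> enc ` wspan m 1"
  proof induction
    case (gen_incl x)
    then show ?case using assms by auto
  next
    case gen_zero
    then show ?case by (auto simp: wring_enc_sel wspan_def intro: zspan.zero)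
  next
    case (gen_neg S)
    then obtain x where x: "x \<in> wspan m 1" "S = enc x" by auto
    then have "- x \<in> wspan m 1" by (auto simp: wspan_def intro: zspan_uminus)
    moreover have "x \<in> wring" using x wspan_1_subset by blast
    ultimately show ?case by (simp add: uminus_wring_enc x(2))
  next
    case (gen_add S T)
    then obtain x y where x: "x \<in> wspan m 1" "S = enc x" "y \<in> wspan m 1" "T = enc y" by auto
    then have "x + y \<in> wspan m 1" by (auto simp: wspan_def intro: zspan_plus)
    moreover have "x \<in> wring" "y \<in> wring" using x wspan_1_subset by blast+
    then have "dec S = x" "dec T = y" using x by simp_all
    ultimately show ?case by (auto simp: wring_enc_sel)
  next
    case (gen_mult S T)
    then obtain x y where x: "x \<in> wspan m 1" "S = enc x" "y \<in> wspan m 1" "T = enc y" by auto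
    then have "x \<circ> y \<in> wspan m 1" using wspan_comp[of x m 1 y 1] wspan_antimono[of 1 "1 + 1" m] by auto
    moreover have "x \<in> wring" "y \<in> wring" using x wspan_1_subset by blast+
    then have "dec S = x" "dec T = y" using x by simp_all
    ultimately show ?case by (auto simp: wring_enc_sel)
  qed
qed

lemma locally_nilpotent_wring_enc: "locally_nilpotent wring_enc"
  unfolding locally_nilpotent_def
proof (intro allI impI)
  fix F assume "finite F \<and> F \<subseteq> carrier wring_enc"
  then have "finite F" "F \<subseteq> carrier wring_enc" by auto
  \<comment> \<open>Finitely many elements share one bound on their letters, which reduces the claim
    to a single \<open>wspan m 1\<close>.\<close>
  then have "\<exists>m. F \<subseteq> enc ` wspan m 1"
  proof (induction F rule: finite_induct)
    case (insert S F)
    then obtain k x where k: "F \<subseteq> enc ` wspan k 1" and x: "x \<in> wring" "S = enc x"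
      by (auto simp: wring_enc_sel)
    obtain l where l: "x \<in> wspan l 1" using wring_eq_Union[OF x(1)] by auto
    have "wspan k 1 \<subseteq> wspan (max k l) 1" "wspan l 1 \<subseteq> wspan (max k l) 1"
      by (simp_all add: wspan_mono)
    then have "insert S F \<subseteq> enc ` wspan (max k l) 1" using k x l by blast
    then show ?case ..
  qed simp
  then obtain m where m: "F \<subseteq> enc ` wspan m 1" ..
  obtain N where N: "N > 0" "wspan m N = {0}" using wspan_eventually_zero by blast
  have "prodl wring_enc xs = \<zero>\<^bsub>wring_enc\<^esub>" if "length xs = N" "set xs \<subseteq> gen_subrng wring_enc F" for xs
    using prodl_wspan[of xs m] gen_subrng_wspan[OF m] that N by (auto simp: wring_enc_sel)
  then show "nilpotent_set wring_enc (gen_subrng wring_enc F)"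
    unfolding nilpotent_set_def using N(1) by (intro exI[of _ N]) auto
qed

section \<open>The element aX of the differential polynomial ring is not quasi-regular\<close>

text \<open>The coefficient sequence of the polynomial aX.\<close>

definition ax :: "nat \<Rightarrow> nat set" where
  "ax n = (if n = 1 then enc (gen 0) else enc 0)"

abbreviation dpr :: "(nat \<Rightarrow> nat set) ring" where
  "dpr \<equiv> diff_poly_ring wring_enc wder"

lemma gen_mem_wring: "gen i \<in> wring"
proof -
  have "wordop [i] \<in> wring" unfolding wring_def by (rule zspan_incl) blast
  then show ?thesis by simp
qed

lemma diff_poly_ring_sel:
  "f \<in> carrier (diff_poly_ring R D) \<longleftrightarrow> (\<forall>n. f n \<in> carrier R) \<and> finite {n. f n \<noteq> \<zero>\<^bsub>R\<^esub>}"
  "\<zero>\<^bsub>diff_poly_ring R D\<^esub> = (\<lambda>n. \<zero>\<^bsub>R\<^esub>)"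
  "f \<oplus>\<^bsub>diff_poly_ring R D\<^esub> g = (\<lambda>n. f n \<oplus>\<^bsub>R\<^esub> g n)"
  by (simp_all add: diff_poly_ring_def)

lemma abelian_group_diff_poly_ring:
  assumes "abelian_group R" shows "abelian_group (diff_poly_ring R D)"
proof -
  interpret abelian_group R by (rule assms)
  show ?thesis
  proof (rule abelian_groupI)
    fix f g assume "f \<in> carrier (diff_poly_ring R D)" "g \<in> carrier (diff_poly_ring R D)"
    then have c: "f n \<in> carrier R" "g n \<in> carrier R"
      and fin: "finite ({n. f n \<noteq> \<zero>\<^bsub>R\<^esub>} \<union> {n. g n \<noteq> \<zero>\<^bsub>R\<^esub>})" for n
      by (simp_all add: diff_poly_ring_sel)
    have "{n. f n \<oplus>\<^bsub>R\<^esub> g n \<noteq> \<zero>\<^bsub>R\<^esub>} \<subseteq> {n. f n \<noteq> \<zero>\<^bsub>R\<^esub>} \<union> {n. g n \<noteq> \<zero>\<^bsub>R\<^esub>}"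
      by auto
    from finite_subset[OF this fin]
    show "f \<oplus>\<^bsub>diff_poly_ring R D\<^esub> g \<in> carrier (diff_poly_ring R D)"
      using c by (simp add: diff_poly_ring_sel)
    show "f \<oplus>\<^bsub>diff_poly_ring R D\<^esub> g = g \<oplus>\<^bsub>diff_poly_ring R D\<^esub> f"
      using c by (simp add: diff_poly_ring_sel a_comm)
  next
    fix f assume f: "f \<in> carrier (diff_poly_ring R D)"
    then have c: "f n \<in> carrier R" and fin: "finite {n. f n \<noteq> \<zero>\<^bsub>R\<^esub>}" for n
      by (simp_all add: diff_poly_ring_sel)
    have "{n. \<ominus>\<^bsub>R\<^esub> f n \<noteq> \<zero>\<^bsub>R\<^esub>} \<subseteq> {n. f n \<noteq> \<zero>\<^bsub>R\<^esub>}" by auto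
    from finite_subset[OF this fin]
    have "(\<lambda>n. \<ominus>\<^bsub>R\<^esub> f n) \<in> carrier (diff_poly_ring R D)"
      using c by (simp add: diff_poly_ring_sel)
    moreover have "(\<lambda>n. \<ominus>\<^bsub>R\<^esub> f n) \<oplus>\<^bsub>diff_poly_ring R D\<^esub> f = \<zero>\<^bsub>diff_poly_ring R D\<^esub>"
      using c by (simp add: diff_poly_ring_sel l_neg)
    ultimately show "\<exists>g\<in>carrier (diff_poly_ring R D). g \<oplus>\<^bsub>diff_poly_ring R D\<^esub> f = \<zero>\<^bsub>diff_poly_ring R D\<^esub>"
      by blast
  qed (simp_all add: diff_poly_ring_sel a_assoc)
qed

lemmas dpr_sel = diff_poly_ring_sel[where R = wring_enc and D = wder, unfolded wring_enc_sel]

lemma ax_mem: "ax \<in> carrier dpr"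
proof -
  have "{n. ax n \<noteq> enc 0} \<subseteq> {1}" by (auto simp: ax_def)
  then have "finite {n. ax n \<noteq> enc 0}" using finite_subset by blast
  then show ?thesis unfolding dpr_sel(1) by (simp add: ax_def gen_mem_wring wring_closed)
qed

text \<open>If a were 0, then 0 would be a quasi-inverse of aX.\<close>

lemma gen_0_neq_0: "gen 0 \<noteq> 0"
proof
  assume "gen 0 = 0"
  then have "gen 0 (xop f) + (0 :: vec \<Rightarrow> vec) f = gen 0 (xop ((0 :: vec \<Rightarrow> vec) f))" for f by simp
  then show False using not_quasi_inverse[OF bounded_shift_zero] by blast
qed

text \<open>This is aX c = a c X + a D(c), read off at the coefficient of X^n. In the double sum
  only i = 1 occurs, with k = 0 and k = 1 giving the two terms.\<close>

lemma ax_mult: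
  assumes y: "y \<in> carrier dpr"
  shows "(ax \<otimes>\<^bsub>dpr\<^esub> y) n =
    enc ((if n = 0 then 0 else gen 0 \<circ> dec (y (n - 1))) +
         (gen 0 \<circ> adx (dec (y n))))"
proof -
  interpret abelian_group wring_enc by (rule abelian_group_wring_enc)
  have yw: "dec (y n) \<in> wring" "y n \<in> carrier wring_enc" for n
    using y by (auto simp: dpr_sel wring_enc_sel dest: spec[of _ n])
  \<comment> \<open>That the support is exactly {1}, not empty, uses that a is nonzero.\<close>
  have s: "{i. ax i \<noteq> \<zero>\<^bsub>wring_enc\<^esub>} = {1}"
    using gen_0_neq_0 by (auto simp: ax_def wring_enc_sel enc_eq_iff gen_mem_wring wring_closed)
  have add_pow_1: "add_pow wring_enc (1::nat) S = S" if "S \<in> carrier wring_enc" for S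
    using add.nat_pow_Suc[of 0 S] that by simp
  have finsum_single: "finsum wring_enc G {j} = G j" if "G j \<in> carrier wring_enc" for G and j :: nat
    using finsum_insert[of "{}" j G] that by simp
  define t where "t i k = add_pow wring_enc (i choose k) (ax i \<otimes>\<^bsub>wring_enc\<^esub> (wder ^^ k) (y (n + k - i)))" for i k
  have "ax 1 \<otimes>\<^bsub>wring_enc\<^esub> y (n - 1) = enc (gen 0 \<circ> dec (y (n - 1)))"
    "ax 1 \<otimes>\<^bsub>wring_enc\<^esub> wder (y n) = enc (gen 0 \<circ> adx (dec (y n)))"
    using yw by (simp_all only: ax_def wring_enc_sel wder_def dec_enc gen_mem_wring adx_mem_wring simp_thms if_True)
  moreover have tc: "enc (gen 0 \<circ> dec (y (n - 1))) \<in> carrier wring_enc" "enc (gen 0 \<circ> adx (dec (y n))) \<in> carrier wring_enc"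
    unfolding wring_enc_sel using yw by (blast intro: wring_comp gen_mem_wring adx_mem_wring)+
  ultimately have t0: "t 1 0 = enc (gen 0 \<circ> dec (y (n - 1)))" and t1: "t 1 1 = enc (gen 0 \<circ> adx (dec (y n)))"
    using add_pow_1 by (simp_all add: t_def)
  define K where "K i = {k. k \<le> i \<and> i \<le> n + k}" for i
  \<comment> \<open>At n = 0 the term k = 0 is excluded, as it would refer to a coefficient of y at
    index -1.\<close>
  have K1: "K 1 = (if n = 0 then {1} else {0, 1})" by (auto simp: K_def)
  have 1: "finsum wring_enc (t 1) (K 1) = (if n = 0 then t 1 1 else t 1 0 \<oplus>\<^bsub>wring_enc\<^esub> t 1 1)"
    using finsum_single[of "t 1" 1] finsum_insert[of "{1}" 0 "t 1"] tc unfolding K1 t0[symmetric] t1[symmetric] by simp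
  then have 2: "finsum wring_enc (t 1) (K 1) \<in> carrier wring_enc"
    using tc unfolding t0[symmetric] t1[symmetric] by simp
  have "(ax \<otimes>\<^bsub>dpr\<^esub> y) n = (\<Oplus>\<^bsub>wring_enc\<^esub> i\<in>{1}. finsum wring_enc (t i) (K i))"
    unfolding t_def K_def by (simp add: diff_poly_ring_def s)
  also have "\<dots> = (if n = 0 then t 1 1 else t 1 0 \<oplus>\<^bsub>wring_enc\<^esub> t 1 1)"
    using finsum_single[of "\<lambda>i. finsum wring_enc (t i) (K i)" 1, OF 2] 1 by simp
  also have "\<dots> = enc ((if n = 0 then 0 else gen 0 \<circ> dec (y (n - 1))) + (gen 0 \<circ> adx (dec (y n))))"
    unfolding t0 t1 wring_enc_sel using yw by (simp add: gen_mem_wring wring_closed)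
  finally show ?thesis .
qed

text \<open>The support of the product lies in that of \<open>y\<close> together with its shift by
  one. Membership is needed to solve the quasi-regularity equation in the additive group.\<close>

lemma ax_mult_mem:
  assumes y: "y \<in> carrier dpr" shows "ax \<otimes>\<^bsub>dpr\<^esub> y \<in> carrier dpr"
proof -
  have yw: "dec (y n) \<in> wring" for n
    using y by (auto simp: dpr_sel dest: spec[of _ n])
  have fin: "finite {n. y n \<noteq> enc 0}" using y by (simp add: dpr_sel)
  have "(ax \<otimes>\<^bsub>dpr\<^esub> y) n = enc 0" if "n \<notin> {n. y n \<noteq> enc 0}" "n \<notin> Suc ` {n. y n \<noteq> enc 0}" for n
  proof -
    have "y n = enc 0" "n \<noteq> 0 \<Longrightarrow> y (n - 1) = enc 0" using that by (cases n; auto)+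
    moreover have "gen 0 \<circ> 0 = (0 :: vec \<Rightarrow> vec)"
      by (rule ext) (simp add: Modules.additive.zero[OF additive_gen])
    ultimately show ?thesis
      unfolding ax_mult[OF y] by (cases "n = 0") (simp_all only: dec_enc zero_mem_wring adx_zero add_0 simp_thms if_True if_False)
  qed
  then have "{n. (ax \<otimes>\<^bsub>dpr\<^esub> y) n \<noteq> enc 0} \<subseteq> {n. y n \<noteq> enc 0} \<union> Suc ` {n. y n \<noteq> enc 0}" by blast
  then have "finite {n. (ax \<otimes>\<^bsub>dpr\<^esub> y) n \<noteq> enc 0}" using fin by (meson finite_UnI finite_imageI finite_subset)
  then show ?thesis
    unfolding dpr_sel(1) using yw by (auto simp: ax_mult[OF y] gen_mem_wring wring_closed)
qed

text \<open>Substituting the operator \<open>xop\<close> for the indeterminate turns a quasi-inverse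
  of aX into an operator with bounded shift that satisfies the equation excluded by
  \<open>not_quasi_inverse\<close>.\<close>

lemma not_right_quasi_regular_ax: "\<not> right_quasi_regular dpr ax"
proof
  interpret abelian_group dpr by (rule abelian_group_diff_poly_ring[OF abelian_group_wring_enc])
  assume "right_quasi_regular dpr ax"
  then obtain y where y: "y \<in> carrier dpr" and "ax \<oplus>\<^bsub>dpr\<^esub> y \<ominus>\<^bsub>dpr\<^esub> ax \<otimes>\<^bsub>dpr\<^esub> y = \<zero>\<^bsub>dpr\<^esub>"
    unfolding right_quasi_regular_def by blast
  then have eq: "ax \<oplus>\<^bsub>dpr\<^esub> y = ax \<otimes>\<^bsub>dpr\<^esub> y"
    using ax_mem ax_mult_mem[OF y] minus_equality[of "ax \<oplus>\<^bsub>dpr\<^esub> y" "\<ominus>\<^bsub>dpr\<^esub> (ax \<otimes>\<^bsub>dpr\<^esub> y)"]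
    by (simp add: minus_eq y)
  define c where "c n = dec (y n)" for n
  have cw: "c n \<in> wring" for n
    using y by (auto simp: c_def dpr_sel dest: spec[of _ n])
  \<comment> \<open>The quasi-regularity equation compared at the coefficient of X^n.\<close>
  have ceq: "(if n = 1 then gen 0 else 0) + c n = (if n = 0 then 0 else gen 0 \<circ> c (n - 1)) +
         (gen 0 \<circ> adx (c n))" for n
  proof -
    have "enc ((if n = 1 then gen 0 else 0) + c n) = (ax \<oplus>\<^bsub>dpr\<^esub> y) n"
      by (simp add: dpr_sel ax_def c_def gen_mem_wring wring_closed)
    also have "\<dots> = enc ((if n = 0 then 0 else gen 0 \<circ> c (n - 1)) + (gen 0 \<circ> adx (c n)))"
      unfolding eq c_def by (rule ax_mult[OF y])
    finally show ?thesis
      by (subst (asm) enc_eq_iff) (auto simp: cw gen_mem_wring wring_closed)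
  qed
  obtain M where M: "c n = 0" if "n \<ge> M" for n
  proof -
    have "finite {n. y n \<noteq> enc 0}" using y by (simp add: dpr_sel)
    then obtain M where "\<forall>n\<in>{n. y n \<noteq> enc 0}. n < M" using finite_nat_set_iff_bounded by auto
    then have "y n = enc 0" if "n \<ge> M" for n using that leD by blast
    then have "c n = 0" if "n \<ge> M" for n using that by (simp only: c_def dec_enc zero_mem_wring)
    then show ?thesis using that by blast
  qed
  define Y where "Y = (\<Sum>n\<le>M. c n \<circ> (xop ^^ n))"
  have Y: "Y f = (\<Sum>n\<le>M. c n ((xop ^^ n) f))" for f
    unfolding Y_def by (induction M) simp_all
  have "bounded_shift Y" unfolding Y_def
    by (intro bounded_shift_sum bounded_shift_comp bounded_shift_wring cw bounded_shift_funpow bounded_shift_xop)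
  moreover have "gen 0 (xop f) + Y f = gen 0 (xop (Y f))" for f
  proof -
    define F where "F n = (xop ^^ n) f" for n
    have FS: "xop (F n) = F (Suc n)" for n by (simp add: F_def)
    have "(if n = 1 then gen 0 (F n) else 0) + c n (F n) =
       (if n = 0 then 0 else gen 0 (c (n - 1) (F n))) + gen 0 (xop (c n (F n)) - c n (F (Suc n)))" for n
    proof -
      have "adx (c n) (F n) = xop (c n (F n)) - c n (F (Suc n))" by (simp add: adx_def FS)
      then show ?thesis using fun_cong[OF ceq[of n], of "F n"] by (simp split: if_splits)
    qed
    \<comment> \<open>Summing up to \<open>Suc M\<close> keeps the index 1 in range even for M = 0
      and makes room for the shift by one; the extra coefficient \<open>c (Suc M)\<close> is
      0.\<close>
    then have "(\<Sum>n\<le>Suc M. (if n = 1 then gen 0 (F n) else 0) + c n (F n)) =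
       (\<Sum>n\<le>Suc M. (if n = 0 then 0 else gen 0 (c (n - 1) (F n))) + gen 0 (xop (c n (F n)) - c n (F (Suc n))))" by simp
    also have "\<dots> = (\<Sum>n\<le>Suc M. (if n = 0 then 0 else gen 0 (c (n - 1) (F n)))) +
        (\<Sum>n\<le>Suc M. gen 0 (xop (c n (F n)))) - (\<Sum>n\<le>Suc M. gen 0 (c n (F (Suc n))))"
      by (simp only: Modules.additive.diff[OF additive_gen] sum.distrib sum_subtractf add_diff_eq)
    \<comment> \<open>After reindexing, the terms a c_n X^(n+1) from the product cancel those
      subtracted in the commutators, which leaves a X Y.\<close>
    also have "(\<Sum>n\<le>Suc M. (if n = 0 then 0 else gen 0 (c (n - 1) (F n)))) = (\<Sum>n\<le>M. gen 0 (c n (F (Suc n))))"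
      by (subst sum.atMost_Suc_shift) simp
    also have "(\<Sum>n\<le>Suc M. gen 0 (c n (F (Suc n)))) = (\<Sum>n\<le>M. gen 0 (c n (F (Suc n))))"
      using M[of "Suc M"] by (simp add: Modules.additive.zero[OF additive_gen])
    also have "(\<Sum>n\<le>Suc M. gen 0 (xop (c n (F n)))) = gen 0 (xop (Y f))"
      using M[of "Suc M"] unfolding Y F_def
      by (simp add: Modules.additive.zero[OF additive_gen] Modules.additive.zero[OF additive_xop]
          Modules.additive.sum[OF additive_gen] Modules.additive.sum[OF additive_xop])
    also have "(\<Sum>n\<le>Suc M. (if n = 1 then gen 0 (F n) else 0) + c n (F n)) = gen 0 (xop f) + Y f"
      using M[of "Suc M"] unfolding Y by (simp add: sum.distrib F_def)
    finally show ?thesis by (simp only: add_diff_cancel_left')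
  qed
  ultimately show False using not_quasi_inverse by blast
qed

theorem mainTheorem10:
  shows "\<exists>(R :: nat set ring) D. rng R \<and> locally_nilpotent R \<and> derivation R D
           \<and> jacobson_radical (diff_poly_ring R D) \<noteq> carrier (diff_poly_ring R D)"
proof (intro exI conjI)
  \<comment> \<open>Every element of the radical is right quasi-regular, so aX lies outside
    it.\<close>
  show "jacobson_radical dpr \<noteq> carrier dpr"
    using ax_mem not_right_quasi_regular_ax unfolding jacobson_radical_def by blast
qed (rule rng_wring_enc locally_nilpotent_wring_enc derivation_wder)+

end
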